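(* Let $(F_1,\dots,F_N)$ be a non-degenerate iterated function system of surjective maps on a complete metric space $(T,d)$, with invariant set $K$, let $X=\{1,\dots,N\}^\infty$ with shift map $\sigma$, let $\mathcal{G}=\mathcal{G}(X,\sigma)$ be the Renault–Deaconu groupoid of $\sigma$, let $L$ be the associated fractafold bundle, and let $\mathcal{G}*L$ be the left action groupoid of the canonical action of $\mathcal{G}$ on $L$. Let $x\in X$ be an infinite word obtained by concatenating all the finite words in $W^*$, where $W=\{1,\dots,N\}$. Then for all $t\in K\subset L(x)$, the orbit of $(x,t)\in L\simeq(\mathcal{G}*L)^0$ is dense in $L$.
   Context: Iterated function system: $(T,d)$ is a complete metric space and $F_1,\dots,F_N:T\to T$ are maps for which there are constants $0<r_i\le R_i<1$ with $r_i d(t,t')\le d(F_i(t),F_i(t'))\le R_i d(t,t')$ for all $t,t'\in T$ (non-degeneracy); each $F_i$ is surjective, hence a homeomorphism. $K\subset T$ is the unique (non-empty) compact set with $K=F_1(K)\cup\dots\cup F_N(K)$. Words: $W=\{1,\dots,N\}$, $W^*=\bigcup_{n\in\mathbb{N}}W^n$, and $X=W^\infty$ is the space of infinite sequences with the topology generated by the cylinders $Z(\omega)=\{x\in X:x_i=\omega_i,\ i=1,\dots,|\omega|\}$, $\omega\in W^*$. The shift $\sigma(x_1x_2x_3\cdots)=x_2x_3\cdots$ is a local homeomorphism of $X$. For $\omega\in W^n$, $F_\omega=F_{\omega_n}\circ\dots\circ F_{\omega_1}$ and $F_\omega^{-1}=F_{\omega_1}^{-1}\circ\dots\circ F_{\omega_n}^{-1}$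 (identity for the empty word). $x(k)=x_1\cdots x_k$. Fractafold bundle: for $\omega\in W^n$ put $L_n(\omega)=F_\omega^{-1}(K)$; for $n\ge0$ let $L_n=\bigsqcup_{\omega\in W^n}Z(\omega)\times L_n(\omega)\subset X\times T$ with the subspace topology. Then $L_n\subset L_{n+1}$, and $L=\bigcup_{n\ge0}L_n$ with the inductive limit topology: $U\subset L$ is open iff $U\cap L_n$ is open in $L_n$ for every $n\ge0$. For $x\in X$, $L(x)=\bigcup_n F_{x(n)}^{-1}(K)$ is the fiber of $L$ over $x$; it contains $K$. Renault–Deaconu groupoid: $\mathcal{G}(X,\sigma)=\{(x,m-n,y)\in X\times\mathbb{Z}\times X:\ m,n\ge 0,\ \sigma^m(x)=\sigma^n(y)\}$, with $(x,m,y)(y,n,w)=(x,m+n,w)$, $(x,n,y)^{-1}=(y,-n,x)$, $r(x,n,y)=x$, $s(x,n,y)=y$ (unit space identified with $X$). Canonical action and action groupoid: $\mathcal{G}$ acts on $L$ by $(x,m-n,y)\cdot(y,t)=(x,F_{x(m)}^{-1}\circ F_{y(n)}(t))$ (with $\sigma^m(x)=\sigma^n(y)$). The action groupoid is $\mathcal{G}*L=\{((x,m-n,y),(y,t)):(x,m-n,y)\in\mathcal{G},(y,t)\in L\}$, with $(\gamma_1,z_1)$, $(\gamma_2,z_2)$ composable iff $z_1=\gamma_2\cdot z_2$, product $(\gamma_1\gamma_2,z_2)$, inverse $(\gamma,z)^{-1}=(\gamma^{-1},\gamma\cdot z)$, and unit space identified with $L$. The orbit of $z=(x,t)\in L$ is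 $\{\gamma\cdot z:\gamma\in\mathcal{G},\ s(\gamma)=x\}$. *)

theory Defs
  imports "HOL-Analysis.Analysis" "HOL-Library.Stream"
begin

section \<open>Iterated function systems\<close>

definition nondegenerate_ifs :: "nat \<Rightarrow> (nat \<Rightarrow> 'a::complete_space \<Rightarrow> 'a) \<Rightarrow> bool" where
  "nondegenerate_ifs N F \<longleftrightarrow>
     (\<forall>i\<in>{1..N}. \<exists>r R. 0 < r \<and> r \<le> R \<and> R < 1 \<and>
        (\<forall>s t. r * dist s t \<le> dist (F i s) (F i t) \<and> dist (F i s) (F i t) \<le> R * dist s t))"

definition invariant_set :: "nat \<Rightarrow> (nat \<Rightarrow> 'a::complete_space \<Rightarrow> 'a) \<Rightarrow> 'a set \<Rightarrow> bool" where
  "invariant_set N F K \<longleftrightarrow> compact K \<and> K \<noteq> {} \<and> K = (\<Union>i\<in>{1..N}. F i ` K)"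


section \<open>Words\<close>

text \<open>
  Finite words are the elements of \<^term>\<open>lists {1..N}\<close>, the empty word included, and infinite
  words are the elements of \<^term>\<open>streams {1..N}\<close>. The shift map is \<^const>\<open>stl\<close>, and the prefix
  $x(k)$ is \<^term>\<open>stake k x\<close>.
\<close>

text \<open>$F_\omega = F_{\omega_n} \circ \dots \circ F_{\omega_1}$: the first letter acts first.\<close>

definition word_map :: "(nat \<Rightarrow> 'a \<Rightarrow> 'a) \<Rightarrow> nat list \<Rightarrow> 'a \<Rightarrow> 'a" where
  "word_map F \<omega> = fold F \<omega>"

text \<open>$F_\omega^{-1} = F_{\omega_1}^{-1} \circ \dots \circ F_{\omega_n}^{-1}$; meaningful if the
  $F_i$ are bijective.\<close>

definition inv_word_map :: "(nat \<Rightarrow> 'a \<Rightarrow> 'a) \<Rightarrow> nat list \<Rightarrow> 'a \<Rightarrow> 'a" where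
  "inv_word_map F \<omega> = foldr (\<lambda>i. inv (F i)) \<omega>"

definition cylinder :: "nat \<Rightarrow> nat list \<Rightarrow> nat stream set" where
  "cylinder N \<omega> = {x \<in> streams {1..N}. stake (length \<omega>) x = \<omega>}"

definition shift_topology :: "nat \<Rightarrow> nat stream topology" where
  "shift_topology N = topology_generated_by (cylinder N ` lists {1..N})"

text \<open>
  The infinite word \<open>x\<close> is the concatenation of some enumeration \<open>ws\<close> of all finite words, in an
  arbitrary order and possibly with repetitions. If $N \ge 1$, the lengths of the finite
  concatenations are unbounded, so \<open>ws\<close> determines \<open>x\<close>; that the empty word occurs in \<open>ws\<close>
  has no effect on \<open>x\<close>.
\<close>

definition concatenates_all_words :: "nat \<Rightarrow> nat stream \<Rightarrow> bool" where
  "concatenates_all_words N x \<longleftrightarrow>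
     (\<exists>ws. sset ws = lists {1..N} \<and>
        (\<forall>k. stake (length (concat (stake k ws))) x = concat (stake k ws)))"


section \<open>The fractafold bundle\<close>

definition fractafold_level ::
  "nat \<Rightarrow> (nat \<Rightarrow> 'a \<Rightarrow> 'a) \<Rightarrow> 'a set \<Rightarrow> nat \<Rightarrow> (nat stream \<times> 'a) set" where
  "fractafold_level N F K n =
     (\<Union>\<omega>\<in>{\<omega> \<in> lists {1..N}. length \<omega> = n}. cylinder N \<omega> \<times> inv_word_map F \<omega> ` K)"

definition fractafold_bundle ::
  "nat \<Rightarrow> (nat \<Rightarrow> 'a \<Rightarrow> 'a) \<Rightarrow> 'a set \<Rightarrow> (nat stream \<times> 'a) set" where
  "fractafold_bundle N F K = (\<Union>n. fractafold_level N F K n)"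

definition fractafold_level_topology ::
  "nat \<Rightarrow> (nat \<Rightarrow> 'a::complete_space \<Rightarrow> 'a) \<Rightarrow> 'a set \<Rightarrow> nat \<Rightarrow> (nat stream \<times> 'a) topology" where
  "fractafold_level_topology N F K n =
     subtopology (prod_topology (shift_topology N) euclidean) (fractafold_level N F K n)"

definition fractafold_topology ::
  "nat \<Rightarrow> (nat \<Rightarrow> 'a::complete_space \<Rightarrow> 'a) \<Rightarrow> 'a set \<Rightarrow> (nat stream \<times> 'a) topology" where
  "fractafold_topology N F K =
     topology (\<lambda>U. U \<subseteq> fractafold_bundle N F K \<and>
       (\<forall>n. openin (fractafold_level_topology N F K n) (U \<inter> fractafold_level N F K n)))"


section \<open>Groupoids\<close>

text \<open>The product is only meaningful on composable pairs, those with
  \<open>gsource g = grange h\<close>.\<close>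

record ('g, 'u) groupoid =
  garrows :: "'g set"
  grange :: "'g \<Rightarrow> 'u"
  gsource :: "'g \<Rightarrow> 'u"
  gmult :: "'g \<Rightarrow> 'g \<Rightarrow> 'g"
  ginverse :: "'g \<Rightarrow> 'g"

definition gorbit :: "('g, 'u) groupoid \<Rightarrow> 'u \<Rightarrow> 'u set" where
  "gorbit G u = {grange G g |g. g \<in> garrows G \<and> gsource G g = u}"

definition renault_deaconu :: "'x set \<Rightarrow> ('x \<Rightarrow> 'x) \<Rightarrow> ('x \<times> int \<times> 'x, 'x) groupoid" where
  "renault_deaconu X \<sigma> = \<lparr>
     garrows = {(x, int m - int n, y) |x m n y. x \<in> X \<and> y \<in> X \<and> (\<sigma> ^^ m) x = (\<sigma> ^^ n) y},
     grange = (\<lambda>(x, k, y). x),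
     gsource = (\<lambda>(x, k, y). y),
     gmult = (\<lambda>(x, k, y) (y', l, w). (x, k + l, w)),
     ginverse = (\<lambda>(x, k, y). (y, - k, x))\<rparr>"

text \<open>The left action groupoid of a groupoid \<open>G\<close> acting on \<open>Z\<close> by \<open>act\<close>, with anchor map \<open>p\<close>.\<close>

definition action_groupoid ::
  "('g, 'u) groupoid \<Rightarrow> ('z \<Rightarrow> 'u) \<Rightarrow> ('g \<Rightarrow> 'z \<Rightarrow> 'z) \<Rightarrow> 'z set \<Rightarrow> ('g \<times> 'z, 'z) groupoid" where
  "action_groupoid G p act Z = \<lparr>
     garrows = {(\<gamma>, z). \<gamma> \<in> garrows G \<and> z \<in> Z \<and> gsource G \<gamma> = p z},
     grange = (\<lambda>(\<gamma>, z). act \<gamma> z),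
     gsource = (\<lambda>(\<gamma>, z). z),
     gmult = (\<lambda>(\<gamma>\<^sub>1, z\<^sub>1) (\<gamma>\<^sub>2, z\<^sub>2). (gmult G \<gamma>\<^sub>1 \<gamma>\<^sub>2, z\<^sub>2)),
     ginverse = (\<lambda>(\<gamma>, z). (ginverse G \<gamma>, act \<gamma> z))\<rparr>"

text \<open>
  The formula for the canonical action refers to \<open>m\<close> and \<open>n\<close>, but an arrow only records their
  difference. The choice does not matter, by \<open>canonical_action_eq\<close> below.
\<close>

definition canonical_action ::
  "(nat \<Rightarrow> 'a \<Rightarrow> 'a) \<Rightarrow> nat stream \<times> int \<times> nat stream \<Rightarrow> nat stream \<times> 'a \<Rightarrow> nat stream \<times> 'a" where
  "canonical_action F = (\<lambda>(x, k, y) (_, t).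
     let (m, n) = (SOME (m, n). k = int m - int n \<and> (stl ^^ m) x = (stl ^^ n) y)
     in (x, inv_word_map F (stake m x) (word_map F (stake n y) t)))"

definition fractafold_groupoid ::
  "nat \<Rightarrow> (nat \<Rightarrow> 'a \<Rightarrow> 'a) \<Rightarrow> 'a set \<Rightarrow>
     ((nat stream \<times> int \<times> nat stream) \<times> (nat stream \<times> 'a), nat stream \<times> 'a) groupoid" where
  "fractafold_groupoid N F K =
     action_groupoid (renault_deaconu (streams {1..N}) stl) fst (canonical_action F)
       (fractafold_bundle N F K)"


section \<open>Basic facts\<close>

lemma bij_nondegenerate_ifs:
  assumes "nondegenerate_ifs N F" "i \<in> {1..N}" "surj (F i)"
  shows "bij (F i)"
proof -
  obtain r where r: "0 < r" "\<And>s t. r * dist s t \<le> dist (F i s) (F i t)"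
    using assms unfolding nondegenerate_ifs_def by blast
  have "s = t" if "F i s = F i t" for s t
    using r(1) r(2)[of s t] that by (simp add: mult_le_0_iff)
  then show ?thesis
    using assms(3) by (simp add: bij_def inj_def)
qed

lemma funpow_stl: "(stl ^^ n) x = sdrop n x"
  by (induction n arbitrary: x) (auto simp: funpow_swap1)

lemma inv_word_map_word_map:
  assumes "\<And>i. i \<in> set \<omega> \<Longrightarrow> inj (F i)"
  shows "inv_word_map F \<omega> (word_map F \<omega> t) = t"
  using assms unfolding inv_word_map_def word_map_def
  by (induction \<omega> arbitrary: t) auto

lemma canonical_action_indep:
  assumes inj: "\<And>i. i \<in> A \<Longrightarrow> inj (F i)"
    and x: "x \<in> streams A" and eq: "sdrop m x = sdrop n y"
  shows "inv_word_map F (stake (m + j) x) (word_map F (stake (n + j) y) t) =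
         inv_word_map F (stake m x) (word_map F (stake n y) t)"
proof -
  have "x !! i \<in> A" for i
    using x by (auto simp: streams_iff_snth)
  then have "set (stake j (sdrop m x)) \<subseteq> A"
    by (auto simp: in_set_conv_nth sdrop_snth)
  then have "inv_word_map F (stake j (sdrop m x)) (word_map F (stake j (sdrop m x)) s) = s" for s
    by (intro inv_word_map_word_map inj) auto
  then show ?thesis
    by (simp add: stake_add[symmetric] inv_word_map_def word_map_def eq del: stake_add)
qed

lemma canonical_action_eq:
  assumes inj: "\<And>i. i \<in> A \<Longrightarrow> inj (F i)"
    and x: "x \<in> streams A" and eq: "(stl ^^ m) x = (stl ^^ n) y"
  shows "canonical_action F (x, int m - int n, y) (y, t) =
         (x, inv_word_map F (stake m x) (word_map F (stake n y) t))"
proof -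
  define P where "P = (\<lambda>(m', n'). int m - int n = int m' - int n' \<and> (stl ^^ m') x = (stl ^^ n') y)"
  obtain p q where pq: "(SOME z. P z) = (p, q)"
    by fastforce
  have "P (m, n)"
    using eq by (simp add: P_def)
  then have "P (p, q)"
    using pq by (metis someI)
  then have d: "int m - int n = int p - int q" and e: "sdrop p x = sdrop q y"
    by (auto simp: P_def funpow_stl)
  have e': "sdrop m x = sdrop n y"
    using eq by (simp add: funpow_stl)
  have "inv_word_map F (stake p x) (word_map F (stake q y) t) =
        inv_word_map F (stake m x) (word_map F (stake n y) t)"
  proof (cases "m \<le> p")
    case True
    then obtain j where "p = m + j" by (metis le_Suc_ex)
    moreover from this d have "q = n + j" by linarith
    ultimately show ?thesis
      using canonical_action_indep[OF inj x e'] by simp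
  next
    case False
    then obtain j where "m = p + j" by (metis nat_le_linear le_Suc_ex)
    moreover from this d have "n = q + j" by linarith
    ultimately show ?thesis
      using canonical_action_indep[OF inj x e] by simp
  qed
  then show ?thesis
    using pq unfolding canonical_action_def P_def by simp
qed

lemma istopology_fractafold:
  "istopology (\<lambda>U. U \<subseteq> fractafold_bundle N F K \<and>
     (\<forall>n. openin (fractafold_level_topology N F K n) (U \<inter> fractafold_level N F K n)))"
  unfolding istopology_def
proof (intro conjI allI impI)
  fix S T n
  assume "S \<subseteq> fractafold_bundle N F K \<and>
      (\<forall>n. openin (fractafold_level_topology N F K n) (S \<inter> fractafold_level N F K n))"
    and "T \<subseteq> fractafold_bundle N F K \<and>
      (\<forall>n. openin (fractafold_level_topology N F K n) (T \<inter> fractafold_level N F K n))"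
  then have "openin (fractafold_level_topology N F K n)
      ((S \<inter> fractafold_level N F K n) \<inter> (T \<inter> fractafold_level N F K n))"
    by blast
  then show "openin (fractafold_level_topology N F K n) (S \<inter> T \<inter> fractafold_level N F K n)"
    by (simp add: Int_ac)
next
  fix \<U> n
  assume "\<forall>S\<in>\<U>. S \<subseteq> fractafold_bundle N F K \<and>
      (\<forall>n. openin (fractafold_level_topology N F K n) (S \<inter> fractafold_level N F K n))"
  then have "openin (fractafold_level_topology N F K n) (\<Union>S\<in>\<U>. S \<inter> fractafold_level N F K n)"
    by blast
  then show "openin (fractafold_level_topology N F K n) (\<Union>\<U> \<inter> fractafold_level N F K n)"
    by (simp add: Int_commute Int_Union)
qed blast+

lemma openin_fractafold_topology:
  "openin (fractafold_topology N F K) U \<longleftrightarrow> U \<subseteq> fractafold_bundle N F K \<and>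
     (\<forall>n. openin (fractafold_level_topology N F K n) (U \<inter> fractafold_level N F K n))"
  by (simp add: fractafold_topology_def topology_inverse'[OF istopology_fractafold])

lemma topspace_shift_topology: "topspace (shift_topology N) = streams {1..N}"
proof -
  have "cylinder N [] = streams {1..N}"
    by (simp add: cylinder_def)
  then show ?thesis
    unfolding shift_topology_def topology_generated_by_topspace
    by (auto simp: cylinder_def)
qed

lemma topspace_fractafold_level_topology:
  "topspace (fractafold_level_topology N F K n) = fractafold_level N F K n"
  by (auto simp: fractafold_level_topology_def topspace_shift_topology fractafold_level_def
      cylinder_def)

lemma topspace_fractafold_topology:
  "topspace (fractafold_topology N F K) = fractafold_bundle N F K"
proof -
  have "fractafold_bundle N F K \<inter> fractafold_level N F K n = fractafold_level N F K n" for n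
    by (auto simp: fractafold_bundle_def)
  then have "openin (fractafold_topology N F K) (fractafold_bundle N F K)"
    unfolding openin_fractafold_topology
    by (metis openin_topspace order_refl topspace_fractafold_level_topology)
  then show ?thesis
    by (metis openin_fractafold_topology openin_subset openin_topspace subset_antisym)
qed

lemma mem_fractafold_bundle:
  assumes "x \<in> streams {1..N}" "t \<in> K"
  shows "(x, t) \<in> fractafold_bundle N F K"
proof -
  have "(x, t) \<in> fractafold_level N F K 0"
    using assms by (simp add: fractafold_level_def cylinder_def inv_word_map_def)
  then show ?thesis
    by (auto simp: fractafold_bundle_def)
qed

lemma gorbit_fractafold_groupoid:
  assumes "(x, t) \<in> fractafold_bundle N F K"
    and "\<And>i. i \<in> {1..N} \<Longrightarrow> inj (F i)"
  shows "gorbit (fractafold_groupoid N F K) (x, t) =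
    {(y, inv_word_map F (stake m y) (word_map F (stake n x) t)) |y m n.
       y \<in> streams {1..N} \<and> (stl ^^ m) y = (stl ^^ n) x}" (is "_ = ?R")
proof -
  have x: "x \<in> streams {1..N}"
    using assms(1) by (auto simp: fractafold_bundle_def fractafold_level_def cylinder_def)
  have "gorbit (fractafold_groupoid N F K) (x, t) =
    {canonical_action F (y, int m - int n, x) (x, t) |y m n.
       y \<in> streams {1..N} \<and> (stl ^^ m) y = (stl ^^ n) x}"
    using assms(1) x
    unfolding gorbit_def fractafold_groupoid_def action_groupoid_def renault_deaconu_def
    by fastforce
  also have "\<dots> = ?R"
    using canonical_action_eq[where A = "{1..N}" and F = F, OF assms(2)] by (intro Collect_cong) metis
  finally show ?thesis .
qed

end

theory Submission
  imports Defs
begin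

text \<open>
  Let $(y, F_{y(n)}^{-1}(u))$ with $u \in K$ be a point of $L_n$. A small neighbourhood of it
  contains all points of $L_n$ whose base point starts with $y(n + k)$ and whose fibre coordinate is
  $F_{y(n)}^{-1}(v)$ with $v$ close to $u$. Choose a word $\alpha$ such that $F_\alpha(K)$ contains
  $u$ and is small. The word $\alpha y_{n+1} \cdots y_{n+k}$ occurs in $x$; let $q$ be the position
  where this $\alpha$ ends. Then $F_{x(q)}(t) \in F_\alpha(K)$ is close to $u$, and
  $(y(n)\sigma^q(x), F_{y(n)}^{-1}(F_{x(q)}(t)))$ is a point of the orbit in the neighbourhood.
\<close>

section \<open>Words acting on the invariant set\<close>

lemma word_map_append: "word_map F (v @ w) t = word_map F w (word_map F v t)"
  by (simp add: word_map_def)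

lemma nondegenerate_ifs_contraction:
  assumes "nondegenerate_ifs N F"
  obtains R where "0 \<le> R" "R < 1"
    "\<And>i s t. i \<in> {1..N} \<Longrightarrow> dist (F i s) (F i t) \<le> R * dist s t"
proof -
  have "\<forall>i\<in>{1..N}. \<exists>R. R < 1 \<and> (\<forall>s t. dist (F i s) (F i t) \<le> R * dist s t)"
    using assms unfolding nondegenerate_ifs_def by blast
  then obtain \<rho> where \<rho>: "\<And>i. i \<in> {1..N} \<Longrightarrow> \<rho> i < 1"
      "\<And>i s t. i \<in> {1..N} \<Longrightarrow> dist (F i s) (F i t) \<le> \<rho> i * dist s t"
    by metis
  \<comment> \<open>Finitely many ratios below 1 have a maximum below 1. Inserting 0 gives
    \<open>0 \<le> R\<close> and keeps the set nonempty when \<open>N = 0\<close>.\<close>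
  define R where "R = Max (insert 0 (\<rho> ` {1..N}))"
  have ge: "\<rho> i \<le> R" if "i \<in> {1..N}" for i
    using that unfolding R_def by (intro Max_ge) auto
  show thesis
  proof
    show "0 \<le> R"
      unfolding R_def by (intro Max_ge) auto
    show "R < 1"
      using \<rho>(1) unfolding R_def by (subst Max_less_iff) auto
    show "dist (F i s) (F i t) \<le> R * dist s t" if "i \<in> {1..N}" for i s t
      using \<rho>(2)[OF that, of s t] mult_right_mono[OF ge[OF that] zero_le_dist[of s t]] by linarith
  qed
qed

lemma dist_word_map_le:
  fixes F :: "nat \<Rightarrow> 'a::metric_space \<Rightarrow> 'a"
  assumes "0 \<le> R" "\<And>i s t. i \<in> A \<Longrightarrow> dist (F i s) (F i t) \<le> R * dist s t" "\<omega> \<in> lists A"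
  shows "dist (word_map F \<omega> s) (word_map F \<omega> t) \<le> R ^ length \<omega> * dist s t"
  using assms(3)
\<comment> \<open>The last letter acts last, so removing it leaves exactly one outer
  contraction.\<close>
proof (induction \<omega> rule: rev_induct)
  case Nil
  then show ?case by (simp add: word_map_def)
next
  case (snoc i \<omega>)
  have "dist (word_map F (\<omega> @ [i]) s) (word_map F (\<omega> @ [i]) t)
      \<le> R * dist (word_map F \<omega> s) (word_map F \<omega> t)"
    using assms(2) snoc.prems by (simp add: word_map_def)
  also have "\<dots> \<le> R * (R ^ length \<omega> * dist s t)"
    using snoc assms(1) by (intro mult_left_mono) auto
  finally show ?case by (simp add: mult.assoc)
qed

lemma invariant_set_word_map:
  assumes "invariant_set N F K" "\<omega> \<in> lists {1..N}" "t \<in> K"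
  shows "word_map F \<omega> t \<in> K"
  using assms(2,3)
proof (induction \<omega> arbitrary: t)
  case Nil
  then show ?case by (simp add: word_map_def)
next
  case (Cons i \<omega>)
  have "(\<Union>i\<in>{1..N}. F i ` K) \<subseteq> K"
    using assms(1) unfolding invariant_set_def by blast
  moreover have "i \<in> {1..N}"
    using Cons by simp
  ultimately have "F i t \<in> K"
    using Cons.prems by blast
  then show ?case
    using Cons by (simp add: word_map_def)
qed

text \<open>An address is found from its end: if \<open>u = F i v\<close> with \<open>v\<close> in
  \<open>K\<close>, then \<open>i\<close> is the last letter, and the search continues with
  \<open>v\<close>.\<close>

lemma invariant_set_address:
  assumes "invariant_set N F K" "u \<in> K"
  shows "\<exists>\<omega>\<in>lists {1..N}. length \<omega> = n \<and> u \<in> word_map F \<omega> ` K"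
  using assms(2)
proof (induction n arbitrary: u)
  case 0
  then show ?case by (auto simp: word_map_def)
next
  case (Suc n)
  then obtain i v where i: "i \<in> {1..N}" "v \<in> K" "u = F i v"
    using assms(1) unfolding invariant_set_def by blast
  obtain \<omega> where "\<omega> \<in> lists {1..N}" "length \<omega> = n" "v \<in> word_map F \<omega> ` K"
    using Suc.IH[OF i(2)] by blast
  with i show ?case
    by (intro bexI[of _ "\<omega> @ [i]"]) (auto simp: word_map_def image_iff)
qed

text \<open>The cells of level \<open>n\<close> have diameter at most
  \<open>R ^ n * diameter K\<close>, so for large \<open>n\<close> a cell through \<open>u\<close>
  lies in any given ball around \<open>u\<close>.\<close>

lemma small_word_map_image:
  assumes "nondegenerate_ifs N F" "invariant_set N F K" "u \<in> K" "0 < e"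
  obtains \<omega> where "\<omega> \<in> lists {1..N}" "word_map F \<omega> ` K \<subseteq> ball u e"
proof -
  obtain R where R: "0 \<le> R" "R < 1"
    "\<And>i s t. i \<in> {1..N} \<Longrightarrow> dist (F i s) (F i t) \<le> R * dist s t"
    using nondegenerate_ifs_contraction[OF assms(1)] by blast
  have "bounded K"
    using assms(2) compact_imp_bounded unfolding invariant_set_def by blast
  then have D: "dist a b \<le> diameter K" if "a \<in> K" "b \<in> K" for a b
    using that by (intro diameter_bounded_bound)
  have "(\<lambda>n. R ^ n * diameter K) \<longlonglongrightarrow> 0 * diameter K"
    using R by (intro tendsto_mult_right LIMSEQ_realpow_zero)
  then have "\<forall>\<^sub>F n in sequentially. R ^ n * diameter K < e"
    using assms(4) by (auto dest: order_tendstoD)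
  then obtain n where n: "R ^ n * diameter K < e"
    unfolding eventually_sequentially by blast
  obtain \<omega> v where \<omega>: "\<omega> \<in> lists {1..N}" "length \<omega> = n" "v \<in> K" "u = word_map F \<omega> v"
    using invariant_set_address[OF assms(2,3)] by blast
  have "word_map F \<omega> w \<in> ball u e" if "w \<in> K" for w
  proof -
    have "dist u (word_map F \<omega> w) \<le> R ^ n * dist v w"
      using dist_word_map_le[OF R(1,3) \<omega>(1), where s = v and t = w] \<omega> by simp
    also have "\<dots> \<le> R ^ n * diameter K"
      using D \<omega>(3) that R(1) by (intro mult_left_mono) auto
    finally show ?thesis
      using n by simp
  qed
  with \<omega>(1) that show thesis by blast
qed

section \<open>Continuity of inverse branches and neighbourhoods in the shift space\<close>

lemma continuous_on_inv_word_map: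
  assumes "nondegenerate_ifs N F" "\<And>i. i \<in> {1..N} \<Longrightarrow> surj (F i)" "\<omega> \<in> lists {1..N}"
  shows "continuous_on UNIV (inv_word_map F \<omega>)"
  using assms(3)
proof (induction \<omega>)
  case Nil
  then show ?case by (simp add: inv_word_map_def)
next
  case (Cons i \<omega>)
  then have i: "i \<in> {1..N}" by simp
  obtain r where r: "0 < r" "\<And>s t. r * dist s t \<le> dist (F i s) (F i t)"
    using assms(1) i unfolding nondegenerate_ifs_def by blast
  \<comment> \<open>The lower bound of non-degeneracy, read at preimages, makes the inverse
    Lipschitz with constant \<open>1 / r\<close>.\<close>
  have "dist (inv (F i) a) (inv (F i) b) \<le> 1 / r * dist a b" for a b
    using r(1) r(2)[of "inv (F i) a" "inv (F i) b"]
    by (simp add: surj_f_inv_f[OF assms(2)[OF i]] field_simps)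
  then have "(1 / r)-lipschitz_on UNIV (inv (F i))"
    using r(1) by (intro lipschitz_onI) auto
  then have "continuous_on UNIV (inv (F i))"
    by (rule lipschitz_on_continuous_on)
  moreover have "continuous_on UNIV (inv_word_map F \<omega>)"
    using Cons by simp
  ultimately have "continuous_on UNIV (inv (F i) \<circ> inv_word_map F \<omega>)"
    by (intro continuous_on_compose) (auto intro: continuous_on_subset)
  then show ?case
    by (simp add: inv_word_map_def o_def)
qed

lemma cylinder_stake_antimono:
  assumes "j \<le> k"
  shows "cylinder N (stake k y) \<subseteq> cylinder N (stake j y)"
proof -
  have "stake j z = stake j y" if "stake k z = stake k y" for z
    using arg_cong[OF that, of "take j"] assms by (simp add: take_stake min_absorb1)
  then show ?thesis
    unfolding cylinder_def length_stake by blast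
qed

lemma openin_shift_topology_cylinder:
  assumes "openin (shift_topology N) U" "y \<in> U"
  obtains k where "cylinder N (stake k y) \<subseteq> U"
proof -
  have "generate_topology_on (cylinder N ` lists {1..N}) U"
    using assms(1) by (simp add: shift_topology_def openin_topology_generated_by_iff)
  \<comment> \<open>Membership of \<open>y\<close> is part of the induction claim because in a union
    it selects the member to descend to. Intersections work because the prefix cylinders of
    \<open>y\<close> are nested.\<close>
  then have "y \<in> U \<Longrightarrow> \<exists>k. cylinder N (stake k y) \<subseteq> U"
  proof induction
    case (Int a b)
    then obtain j k where "cylinder N (stake j y) \<subseteq> a" "cylinder N (stake k y) \<subseteq> b"
      by blast
    then have "cylinder N (stake (max j k) y) \<subseteq> a \<inter> b"
      using cylinder_stake_antimono[of j "max j k" N y] cylinder_stake_antimono[of k "max j k" N y]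
      by auto
    then show ?case by blast
  next
    case (UN \<U>)
    then show ?case by blast
  next
    case (Basis s)
    then obtain \<omega> where "s = cylinder N \<omega>" by blast
    moreover from this Basis have "\<omega> = stake (length \<omega>) y"
      by (simp add: cylinder_def)
    ultimately have "cylinder N (stake (length \<omega>) y) \<subseteq> s"
      by simp
    then show ?case by blast
  qed simp
  with assms(2) that show thesis by blast
qed

section \<open>Occurrences of finite words in x, and density of the orbit\<close>

lemma concatenates_all_words_occurrence:
  assumes "concatenates_all_words N x" "w \<in> lists {1..N}"
  obtains q where "stake (length w) (sdrop q x) = w"
proof -
  obtain ws where ws: "sset ws = lists {1..N}"
      "\<And>k. stake (length (concat (stake k ws))) x = concat (stake k ws)"
    using assms(1) unfolding concatenates_all_words_def by blast
  obtain k where k: "ws !! k = w"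
    using assms(2) ws(1) by (metis sset_range imageE)
  let ?p = "concat (stake k ws)"
  \<comment> \<open>Two consecutive concatenations are prefixes of \<open>x\<close> and differ by
    \<open>w\<close>, so \<open>w\<close> occurs right after the first one.\<close>
  have "concat (stake (Suc k) ws) = ?p @ w"
    using k by (simp add: stake_Suc del: stake.simps)
  then have "stake (length ?p + length w) x = ?p @ w"
    using ws(2)[of "Suc k"] by (simp del: stake.simps)
  then have "stake (length ?p) x @ stake (length w) (sdrop (length ?p) x) = ?p @ w"
    by (simp only: stake_add)
  then have "stake (length w) (sdrop (length ?p) x) = w"
    using ws(2)[of k] by simp
  with that show thesis by blast
qed

theorem proposition3p8:
  fixes N :: nat
    and F :: "nat \<Rightarrow> 'a::complete_space \<Rightarrow> 'a"
    and K :: "'a set"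
    and x :: "nat stream"
    and t :: 'a
  assumes "nondegenerate_ifs N F"
    and "\<And>i. i \<in> {1..N} \<Longrightarrow> surj (F i)"
    and "invariant_set N F K"
    and "x \<in> streams {1..N}"
    and "concatenates_all_words N x"
    and "t \<in> K"
  shows "fractafold_topology N F K closure_of gorbit (fractafold_groupoid N F K) (x, t)
           = fractafold_bundle N F K"
proof
  let ?T = "fractafold_topology N F K" and ?O = "gorbit (fractafold_groupoid N F K) (x, t)"
  show "?T closure_of ?O \<subseteq> fractafold_bundle N F K"
    using closure_of_subset_topspace[of ?T] by (simp add: topspace_fractafold_topology)
  have inj: "inj (F i)" if "i \<in> {1..N}" for i
    using bij_nondegenerate_ifs[OF assms(1) that assms(2)[OF that]] by (rule bij_is_inj)
  have orbit: "?O = {(y, inv_word_map F (stake m y) (word_map F (stake n x) t)) |y m n.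
       y \<in> streams {1..N} \<and> (stl ^^ m) y = (stl ^^ n) x}"
    by (intro gorbit_fractafold_groupoid mem_fractafold_bundle assms inj)
  show "fractafold_bundle N F K \<subseteq> ?T closure_of ?O"
  proof
    fix z assume z: "z \<in> fractafold_bundle N F K"
    have "\<exists>p\<in>?O. p \<in> U" if U: "z \<in> U" "openin ?T U" for U
    proof -
      \<comment> \<open>One level containing \<open>z\<close> suffices: the orbit point built below
        lies in the same level, so only the trace of \<open>U\<close> on that level matters.\<close>
      obtain n where n: "z \<in> fractafold_level N F K n"
        using z unfolding fractafold_bundle_def by blast
      then obtain y u where y: "y \<in> streams {1..N}" and u: "u \<in> K"
        and z_eq: "z = (y, inv_word_map F (stake n y) u)"
        by (auto simp: fractafold_level_def cylinder_def)
      obtain W where W: "openin (prod_topology (shift_topology N) euclidean) W"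
        "U \<inter> fractafold_level N F K n = W \<inter> fractafold_level N F K n"
        using U(2) unfolding openin_fractafold_topology fractafold_level_topology_def
          openin_subtopology by meson
      then have "(y, inv_word_map F (stake n y) u) \<in> W"
        using U(1) n z_eq by blast
      then obtain A V where AV: "openin (shift_topology N) A" "open V" "y \<in> A"
        "inv_word_map F (stake n y) u \<in> V" "A \<times> V \<subseteq> W"
        using W(1)[unfolded openin_prod_topology_alt open_openin[symmetric], rule_format,
            of y "inv_word_map F (stake n y) u"]
        by blast
      obtain k where k: "cylinder N (stake k y) \<subseteq> A"
        using openin_shift_topology_cylinder[OF AV(1,3)] .
      have yN: "y !! i \<in> {1..N}" for i
        using y by (simp add: streams_iff_snth)
      have lists_y: "stake i (sdrop j y) \<in> lists {1..N}" for i j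
        using yN by (auto simp: in_set_conv_nth sdrop_snth)
      \<comment> \<open>Pulling \<open>V\<close> back reduces the approximation in the fibre to one
        inside \<open>K\<close>, near \<open>u\<close>.\<close>
      have "open (inv_word_map F (stake n y) -` V)"
        using continuous_on_inv_word_map[OF assms(1,2) lists_y[of n 0]] AV(2)
        by (simp add: open_vimage)
      then obtain e where e: "0 < e" "ball u e \<subseteq> inv_word_map F (stake n y) -` V"
        using AV(4) open_contains_ball by blast
      obtain \<alpha> where \<alpha>: "\<alpha> \<in> lists {1..N}" "word_map F \<alpha> ` K \<subseteq> ball u e"
        using small_word_map_image[OF assms(1,3) u e(1)] .
      let ?w = "\<alpha> @ stake k (sdrop n y)"
      obtain p where occ: "stake (length ?w) (sdrop p x) = ?w"
        using concatenates_all_words_occurrence[OF assms(5), of ?w] \<alpha>(1) lists_y by auto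
      have p: "stake (length \<alpha>) (sdrop p x) = \<alpha>"
        "stake k (sdrop (p + length \<alpha>) x) = stake k (sdrop n y)"
        using occ by (simp_all add: stake_add[symmetric] sdrop_add[symmetric]
            del: stake_add sdrop_add)
      define q where "q = p + length \<alpha>"
      have xN: "x !! i \<in> {1..N}" for i
        using assms(4) by (simp add: streams_iff_snth)
      have lists_x: "stake i x \<in> lists {1..N}" for i
        using xN by (auto simp: in_set_conv_nth)
      have inK: "word_map F (stake i x) t \<in> K" for i
        by (rule invariant_set_word_map[OF assms(3) lists_x assms(6)])
      \<comment> \<open>The prefix of length \<open>p\<close> is uncontrolled, but it acts first and
        keeps \<open>t\<close> in \<open>K\<close>; \<alpha> acts last and decides the cell.\<close>
      have "word_map F (stake q x) t = word_map F \<alpha> (word_map F (stake p x) t)"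
        using p(1) by (simp add: q_def stake_add[symmetric] word_map_append del: stake_add)
      then have v: "word_map F (stake q x) t \<in> ball u e"
        using \<alpha>(2) inK[of p] by (metis image_subset_iff)
      \<comment> \<open>The first \<open>n\<close> letters of \<open>y\<close> fix the inverse
        branch and the level; the tail of \<open>x\<close> puts \<open>y'\<close> in the orbit of
        \<open>x\<close> under the shift groupoid.\<close>
      define y' where "y' = stake n y @- sdrop q x"
      have y': "y' \<in> streams {1..N}"
        using lists_y[of n 0] xN unfolding y'_def
        by (intro shift_streams) (auto simp: streams_iff_snth sdrop_snth)
      have drop_y': "sdrop n y' = sdrop q x" and take_y': "stake n y' = stake n y"
        by (simp_all add: y'_def stake_shift sdrop_shift)
      \<comment> \<open>Only \<open>k\<close> letters are needed for \<open>A\<close>; agreement on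
        \<open>n + k\<close> avoids comparing \<open>n\<close> with \<open>k\<close>.\<close>
      have "stake (n + k) y' = stake (n + k) y"
        using p(2) by (simp add: stake_add[symmetric] drop_y' take_y' q_def del: stake_add)
      then have "y' \<in> A"
        using k y' cylinder_stake_antimono[of k "n + k" N y] by (auto simp: cylinder_def)
      moreover define s where "s = inv_word_map F (stake n y) (word_map F (stake q x) t)"
      moreover have "s \<in> V"
        using v e(2) by (auto simp: s_def)
      ultimately have "(y', s) \<in> W"
        using AV(5) by blast
      moreover have "(y', s) \<in> fractafold_level N F K n"
        using inK[of q] y' take_y' lists_y[of n 0]
        by (auto simp: fractafold_level_def cylinder_def s_def intro!: exI[of _ "stake n y"])
      ultimately have "(y', s) \<in> U"
        using W(2) by blast
      \<comment> \<open>The arrow \<open>(y', int n - int q, x)\<close> carries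
        \<open>(x, t)\<close> to \<open>(y', s)\<close>.\<close>
      moreover have "(stl ^^ n) y' = (stl ^^ q) x"
        by (simp add: funpow_stl drop_y')
      then have "(y', s) \<in> ?O"
        using y' take_y' unfolding orbit s_def by force
      ultimately show ?thesis by blast
    qed
    then show "z \<in> ?T closure_of ?O"
      using z unfolding in_closure_of topspace_fractafold_topology by blast
  qed
qed

end
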